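(* Let $K$ be an algebraically closed field with a nontrivial non-Archimedean valuation. (i) For $n=1$, for every finite quiver $Q$, every $Q$-representation $R$ with $R_i=K^1$ for all vertices $i$, and every dimension vector $\mathbf{d}$, one has $\operatorname{QDr}(R,\mathbf{d};1)=\overline{\operatorname{trop}}(\operatorname{QGr}(R,\mathbf{d};1))$. (ii) For every $n\ge2$, for every finite quiver $Q$, $Q$-representation $R$ with $R_i=K^n$ and dimension vector $\mathbf{d}$, one has $\overline{\operatorname{trop}}(\operatorname{QGr}(R,\mathbf{d};n))\subseteq\operatorname{QDr}(R,\mathbf{d};n)$, and there exist a finite quiver $Q$, a $Q$-representation $R$ with $R_i=K^n$, and a dimension vector $\mathbf{d}$ for which this containment is strict.
   Context: A finite quiver $Q=(V,A,s,t)$; a $Q$-representation $R$ assigns $R_i=K^n$ to each vertex and a matrix $A^{\alpha}\in K^{n\times n}$ to each arrow $\alpha$. A dimension vector is $\mathbf{d}=(d_i)_{i\in V}$ with $0\le d_i\le n$. A subrepresentation consists of subspaces $N_i\subseteq K^n$ with $A^\alpha N_{s(\alpha)}\subseteq N_{t(\alpha)}$. $\operatorname{QGr}(R,\mathbf{d};n)$ is the set of subrepresentations with $\dim N_i=d_i$, embedded in $\prod_i\mathbb{P}^{\binom{n}{d_i}-1}$ via Plücker coordinates; $\overline{\operatorname{trop}}(\operatorname{QGr}(R,\mathbf{d};n))$ is the Euclidean closure in $\prod_i\mathbb{P}(\mathbb{T}^{\binom{n}{d_i}})$ of the coordinatewise valuations of its points, where $\mathbb{T}=\mathbb{R}\cup\{\infty\}$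 and $\mathbb{P}(\mathbb{T}^N)=(\mathbb{T}^N\setminus\{(\infty,\dots,\infty)\})/\mathbb{R}\mathbf{1}$. Quiver Dressian $\operatorname{QDr}(R,\mathbf{d};n)$: tuples $(p^{(i)})_{i\in V}$, $p^{(i)}\in\mathbb{P}(\mathbb{T}^{\binom{n}{d_i}})$, such that for each vertex $i$ ($r=d_i$) and all $I\in\binom{[n]}{r-1}$, $J\in\binom{[n]}{r+1}$ the minimum $\min_{j\in J\setminus I}(p^{(i)}_{I\cup j}+p^{(i)}_{J\setminus j})$ is attained at least twice, and for each arrow $\alpha$ ($r=d_{s(\alpha)}$, $s=d_{t(\alpha)}$) and all $I\in\binom{[n]}{r-1}$, $J\in\binom{[n]}{s+1}$ the minimum $\min_{j\in[n]\setminus I,i\in J}(\mathrm{val}(A^{\alpha}_{i,j})+p^{(s(\alpha))}_{I\cup j}+p^{(t(\alpha))}_{J\setminus i})$ is attained at least twice (a minimum equal to $\infty$ counts as attained twice). These are the tropicalizations of the Grassmann–Plücker relations and of the quiver Plücker relations $\sum_{j\in[n]\setminus I,i\in J}\pm(A^\alpha)_{i,j}p_{I\cup j}p_{J\setminus i}$, whose common zero set is $\operatorname{QGr}(R,\mathbf{d};n)$. *)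

theory Defs
  imports "HOL-Analysis.Analysis" "HOL-Computational_Algebra.Polynomial"
begin

definition alg_closed :: "('k::field) itself \<Rightarrow> bool" where
  "alg_closed _ \<longleftrightarrow> (\<forall>p :: 'k poly. degree p \<ge> 1 \<longrightarrow> (\<exists>z. poly p z = 0))"

definition nonarch_valuation :: "('k::field \<Rightarrow> ereal) \<Rightarrow> bool" where
  "nonarch_valuation val \<longleftrightarrow>
     (\<forall>x. val x = \<infinity> \<longleftrightarrow> x = 0) \<and>
     (\<forall>x. val x \<noteq> -\<infinity>) \<and>
     (\<forall>x y. val (x * y) = val x + val y) \<and>
     (\<forall>x y. min (val x) (val y) \<le> val (x + y))"

definition nontrivial_valuation :: "('k::field \<Rightarrow> ereal) \<Rightarrow> bool" where
  "nontrivial_valuation val \<longleftrightarrow> (\<exists>x. x \<noteq> 0 \<and> val x \<noteq> 0)"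

text \<open>A finite quiver: finite vertex set V, finite arrow set Arr (both labelled by
  natural numbers), source and target maps src, tgt. A dimension vector d with
  0 <= d i <= n for all vertices.  A representation with R_i = K^n is given by
  n x n matrices A alpha (entries A alpha i j for i, j < n; other entries are irrelevant).\<close>
definition quiver_dimvec :: "nat set \<Rightarrow> nat set \<Rightarrow> (nat \<Rightarrow> nat) \<Rightarrow> (nat \<Rightarrow> nat)
    \<Rightarrow> nat \<Rightarrow> (nat \<Rightarrow> nat) \<Rightarrow> bool" where
  "quiver_dimvec V Arr src tgt n d \<longleftrightarrow>
     finite V \<and> finite Arr \<and> (\<forall>a\<in>Arr. src a \<in> V \<and> tgt a \<in> V) \<and> (\<forall>i\<in>V. d i \<le> n)"

definition kvecs :: "nat \<Rightarrow> (nat \<Rightarrow> 'k::field) set" where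
  "kvecs n = {v. \<forall>j\<ge>n. v j = 0}"

definition matvec :: "nat \<Rightarrow> (nat \<Rightarrow> nat \<Rightarrow> 'k::field) \<Rightarrow> (nat \<Rightarrow> 'k) \<Rightarrow> (nat \<Rightarrow> 'k)" where
  "matvec n A v = (\<lambda>i. if i < n then (\<Sum>j<n. A i j * v j) else 0)"

definition rowcomb :: "nat \<Rightarrow> (nat \<Rightarrow> nat \<Rightarrow> 'k::field) \<Rightarrow> (nat \<Rightarrow> 'k) \<Rightarrow> (nat \<Rightarrow> 'k)" where
  "rowcomb r M c = (\<lambda>j. \<Sum>k<r. c k * M k j)"

definition basis_matrix :: "nat \<Rightarrow> nat \<Rightarrow> (nat \<Rightarrow> nat \<Rightarrow> 'k::field) \<Rightarrow> (nat \<Rightarrow> 'k) set \<Rightarrow> bool" where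
  "basis_matrix n r M N \<longleftrightarrow>
     (\<forall>k j. n \<le> j \<longrightarrow> M k j = 0) \<and>
     (\<forall>c. rowcomb r M c = (\<lambda>_. 0) \<longrightarrow> (\<forall>k<r. c k = 0)) \<and>
     N = range (rowcomb r M)"

definition subspace_of_dim :: "nat \<Rightarrow> nat \<Rightarrow> (nat \<Rightarrow> 'k::field) set \<Rightarrow> bool" where
  "subspace_of_dim n r N \<longleftrightarrow> (\<exists>M. basis_matrix n r M N)"

definition ldet :: "nat \<Rightarrow> (nat \<Rightarrow> nat \<Rightarrow> 'k::field) \<Rightarrow> 'k" where
  "ldet r B = (\<Sum>p\<in>{p. p permutes {..<r}}. of_int (sign p) * (\<Prod>k<r. B k (p k)))"

definition plucker :: "nat \<Rightarrow> (nat \<Rightarrow> nat \<Rightarrow> 'k::field) \<Rightarrow> nat set \<Rightarrow> 'k" where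
  "plucker r M I = ldet r (\<lambda>k l. M k (sorted_list_of_set I ! l))"

definition subsets_of_size :: "nat \<Rightarrow> nat \<Rightarrow> nat set set" where
  "subsets_of_size n r = {I. I \<subseteq> {..<n} \<and> card I = r}"

definition QGr :: "nat set \<Rightarrow> nat set \<Rightarrow> (nat \<Rightarrow> nat) \<Rightarrow> (nat \<Rightarrow> nat)
    \<Rightarrow> (nat \<Rightarrow> nat \<Rightarrow> nat \<Rightarrow> 'k::field) \<Rightarrow> (nat \<Rightarrow> nat) \<Rightarrow> nat \<Rightarrow> (nat \<Rightarrow> (nat \<Rightarrow> 'k) set) set" where
  "QGr V Arr src tgt A d n =
     {N. (\<forall>i\<in>V. subspace_of_dim n (d i) (N i)) \<and>
         (\<forall>a\<in>Arr. matvec n (A a) ` N (src a) \<subseteq> N (tgt a))}"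

text \<open>A point of prod_{i in V} P(T^{binom(n, d_i)}) is represented by a representative
  x :: nat => nat set => ereal, where x i I is the I-th coordinate at vertex i.
  Canonical conventions: coordinates not indexed by a vertex i in V and a set
  I in binom([n], d_i) are infinity.  A subset of the tropical product space is
  represented by the set of all representatives of its points (which is stable under
  adding a real constant c_i to all coordinates at vertex i).\<close>

definition trop_rep :: "nat set \<Rightarrow> (nat \<Rightarrow> nat) \<Rightarrow> nat \<Rightarrow> (nat \<Rightarrow> nat set \<Rightarrow> ereal) \<Rightarrow> bool" where
  "trop_rep V d n x \<longleftrightarrow>
     (\<forall>i I. (i \<notin> V \<or> I \<notin> subsets_of_size n (d i)) \<longrightarrow> x i I = \<infinity>) \<and>
     (\<forall>i I. x i I \<noteq> -\<infinity>) \<and>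
     (\<forall>i\<in>V. \<exists>I. x i I \<noteq> \<infinity>)"

definition trop_QGr :: "('k::field \<Rightarrow> ereal) \<Rightarrow> nat set \<Rightarrow> nat set \<Rightarrow> (nat \<Rightarrow> nat) \<Rightarrow> (nat \<Rightarrow> nat)
    \<Rightarrow> (nat \<Rightarrow> nat \<Rightarrow> nat \<Rightarrow> 'k) \<Rightarrow> (nat \<Rightarrow> nat) \<Rightarrow> nat \<Rightarrow> (nat \<Rightarrow> nat set \<Rightarrow> ereal) set" where
  "trop_QGr val V Arr src tgt A d n =
     {x. \<exists>N\<in>QGr V Arr src tgt A d n. \<exists>M c.
          (\<forall>i\<in>V. basis_matrix n (d i) (M i) (N i)) \<and>
          (\<forall>i I. x i I = (if i \<in> V \<and> I \<in> subsets_of_size n (d i)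
                           then val (plucker (d i) (M i) I) + ereal (c i) else \<infinity>))}"

text \<open>Euclidean closure in prod_i P(T^{binom(n,d_i)}).  Since the quotient map
  T^N - {infinity vector} -> P(T^N) is open and trop_QGr is saturated, this is the closure
  of the set of representatives (in the product topology of the extended reals)
  intersected with the set of valid representatives.\<close>
definition trop_closure_QGr :: "('k::field \<Rightarrow> ereal) \<Rightarrow> nat set \<Rightarrow> nat set \<Rightarrow> (nat \<Rightarrow> nat) \<Rightarrow> (nat \<Rightarrow> nat)
    \<Rightarrow> (nat \<Rightarrow> nat \<Rightarrow> nat \<Rightarrow> 'k) \<Rightarrow> (nat \<Rightarrow> nat) \<Rightarrow> nat \<Rightarrow> (nat \<Rightarrow> nat set \<Rightarrow> ereal) set" where
  "trop_closure_QGr val V Arr src tgt A d n =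
     closure (trop_QGr val V Arr src tgt A d n) \<inter> {x. trop_rep V d n x}"

text \<open>The minimum of f over S is attained at least twice (a minimum equal to infinity,
  including the empty minimum, counts as attained twice).\<close>
definition min_twice :: "'a set \<Rightarrow> ('a \<Rightarrow> ereal) \<Rightarrow> bool" where
  "min_twice S f \<longleftrightarrow>
     (INF s\<in>S. f s) = \<infinity> \<or>
     (\<exists>a\<in>S. \<exists>b\<in>S. a \<noteq> b \<and> f a = (INF s\<in>S. f s) \<and> f b = (INF s\<in>S. f s))"

definition QDr :: "('k::field \<Rightarrow> ereal) \<Rightarrow> nat set \<Rightarrow> nat set \<Rightarrow> (nat \<Rightarrow> nat) \<Rightarrow> (nat \<Rightarrow> nat)
    \<Rightarrow> (nat \<Rightarrow> nat \<Rightarrow> nat \<Rightarrow> 'k) \<Rightarrow> (nat \<Rightarrow> nat) \<Rightarrow> nat \<Rightarrow> (nat \<Rightarrow> nat set \<Rightarrow> ereal) set" where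
  "QDr val V Arr src tgt A d n =
     {x. trop_rep V d n x \<and>
         (\<forall>i\<in>V. \<forall>I J. I \<in> subsets_of_size n (d i - 1) \<and> 1 \<le> d i \<and>
                       J \<in> subsets_of_size n (d i + 1) \<longrightarrow>
            min_twice (J - I) (\<lambda>j. x i (insert j I) + x i (J - {j}))) \<and>
         (\<forall>a\<in>Arr. \<forall>I J. I \<in> subsets_of_size n (d (src a) - 1) \<and> 1 \<le> d (src a) \<and>
                       J \<in> subsets_of_size n (d (tgt a) + 1) \<longrightarrow>
            min_twice (({..<n} - I) \<times> J)
              (\<lambda>(j, k). val (A a k j) + x (src a) (insert j I) + x (tgt a) (J - {k})))}"

end

theory Submission
  imports Defs "Jordan_Normal_Form.Determinant"
begin

text \<open>The Grassmann--Pluecker relations are the quiver Pluecker relations of the identity map.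
  Both hold on the quiver Grassmannian, a vanishing sum attains its minimal valuation at least
  twice, and this survives limits because a unique finite minimum is an open condition.
  For \<open>n = 1\<close> the only conditions are that arrows from dimension 1 to dimension 0 vanish, in the
  Dressian as well as in the Grassmannian. For \<open>n \<ge> 2\<close> the containment is strict for a single
  loop carrying the shear \<open>1 + E\<^sub>0\<^sub>1\<close>, in dimension 1: two terms of its relations that
  cancel algebraically do not cancel tropically.\<close>

subsection \<open>Determinants and Pluecker relations\<close>

text \<open>Makes Laplace expansion and the alternating property of the matrix determinant available
  for \<open>ldet\<close>.\<close>

lemma ldet_eq_det: "ldet r B = Determinant.det (Matrix.mat r r (\<lambda>(i, j). B i j))"
proof -
  have "(\<Prod>k<r. B k (p k)) = (\<Prod>k<r. Matrix.mat r r (\<lambda>(i, j). B i j) $$ (k, p k))"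
    if "p permutes {..<r}" for p
    using permutes_in_image[OF that] by (intro prod.cong) auto
  then show ?thesis
    by (simp add: ldet_def Determinant.det_def atLeast0LessThan)
qed

lemma ldet_cong:
  assumes "\<And>k l. k < r \<Longrightarrow> l < r \<Longrightarrow> B k l = C k l"
  shows "ldet r B = ldet r C"
  unfolding ldet_eq_det using assms by (intro arg_cong[of _ _ Determinant.det] eq_matI) auto

text \<open>A permutation of columns is a permutation of rows of the transpose, and transposing
  preserves the determinant.\<close>

lemma ldet_permute_columns:
  assumes p: "p permutes {..<r}"
  shows "ldet r (\<lambda>k l. B k (p l)) = of_int (sign p) * ldet r B"
proof -
  let ?T = "Matrix.mat r r (\<lambda>(i, j). B j i)"
  have *: "ldet r C = Determinant.det (Matrix.mat r r (\<lambda>(i, j). C j i))"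
    for C :: "nat \<Rightarrow> nat \<Rightarrow> 'a"
  proof -
    have "transpose_mat (Matrix.mat r r (\<lambda>(i, j). C i j)) = Matrix.mat r r (\<lambda>(i, j). C j i)"
      by (intro eq_matI) auto
    then show ?thesis
      unfolding ldet_eq_det by (metis det_transpose mat_carrier)
  qed
  have "Matrix.mat r r (\<lambda>(i, j). B j (p i)) = Matrix.mat r r (\<lambda>(i, j). ?T $$ (p i, j))"
    using permutes_in_image[OF p] by (intro eq_matI) auto
  then have "ldet r (\<lambda>k l. B k (p l)) = of_int (sign p) * Determinant.det ?T"
    unfolding * using det_permute_rows[of ?T r p] p by (simp add: atLeast0LessThan)
  then show ?thesis
    by (simp add: *)
qed

text \<open>\<open>plucker\<close> takes the columns in increasing order, and any other order
  differs from it by a permutation. The sign is left unspecified since valuations do not see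
  it.\<close>

lemma ldet_columns_eq_plucker:
  assumes "distinct xs" "set xs = I" "length xs = r"
  shows "\<exists>\<epsilon>\<in>{1, -1}. ldet r (\<lambda>k l. M k (xs ! l)) = \<epsilon> * plucker r M I"
proof -
  let ?ys = "sorted_list_of_set I"
  have "finite I"
    using assms(2) by auto
  then have "mset xs = mset ?ys"
    using assms by (subst set_eq_iff_mset_eq_distinct[symmetric]) auto
  then obtain p where p: "p permutes {..<length ?ys}" "permute_list p ?ys = xs"
    by (rule mset_eq_permutation)
  have len: "length ?ys = r"
    using assms distinct_card by fastforce
  have "ldet r (\<lambda>k l. M k (xs ! l)) = ldet r (\<lambda>k l. M k (?ys ! p l))"
    using p len by (intro ldet_cong) (metis permute_list_nth)
  also have "\<dots> = of_int (sign p) * plucker r M I"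
    unfolding plucker_def using p len by (intro ldet_permute_columns) auto
  finally show ?thesis
    by (intro bexI[of _ "of_int (sign p)"]) (auto simp: sign_def)
qed

text \<open>Put column \<open>j\<close> in front of the columns indexed by \<open>I\<close> and
  expand along it. The cofactors do not depend on \<open>j\<close>, so the determinant, as a
  function of \<open>j\<close>, is a combination of the rows of \<open>M\<close>.\<close>

lemma plucker_vector_in_row_space:
  assumes I: "I \<in> subsets_of_size n (r - 1)" and r: "1 \<le> r"
  shows "\<exists>c \<epsilon>. (\<forall>j. \<epsilon> j \<in> {1, -1 :: 'k::field}) \<and>
    (\<forall>j. rowcomb r M c j = (if j \<in> I then 0 else \<epsilon> j * plucker r M (insert j I)))"
proof -
  define js where "js = sorted_list_of_set I"
  have fin: "finite I"
    using I finite_subset by (auto simp: subsets_of_size_def)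
  have js: "distinct js" "set js = I" "length js = r - 1"
    using I fin by (auto simp: js_def subsets_of_size_def)
  define B where "B j = Matrix.mat r r (\<lambda>(k, l). M k ((j # js) ! l))" for j
  define c where "c k = cofactor (B 0) k 0" for k
  \<comment> \<open>Cofactors along column 0 ignore the entries of that column, the one place where
    \<open>B j\<close> depends on \<open>j\<close>.\<close>
  have cof: "cofactor (B j) k 0 = c k" for j k
  proof -
    have "mat_delete (B j) k 0 = mat_delete (B 0) k 0"
      by (intro eq_matI) (auto simp: mat_delete_def B_def)
    then show ?thesis
      by (simp add: c_def cofactor_def)
  qed
  have row: "rowcomb r M c j = ldet r (\<lambda>k l. M k ((j # js) ! l))" for j
  proof -
    have "Determinant.det (B j) = (\<Sum>k<r. B j $$ (k, 0) * cofactor (B j) k 0)"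
      using r by (intro laplace_expansion_column) (auto simp: B_def)
    also have "\<dots> = (\<Sum>k<r. c k * M k j)"
      using r unfolding cof by (intro sum.cong) (auto simp: B_def)
    finally show ?thesis
      by (simp add: rowcomb_def ldet_eq_det B_def)
  qed
  have zero: "rowcomb r M c j = 0" if j: "j \<in> I" for j
  proof -
    obtain l where l: "l < r - 1" "js ! l = j"
      using j js(2,3) by (metis in_set_conv_nth)
    \<comment> \<open>The column \<open>j\<close> occurs twice: at position 0 and, shifted by the
      prepended entry, at position \<open>Suc l\<close>.\<close>
    have "Determinant.det (B j) = 0"
      using l by (intro det_identical_columns[of _ r 0 "Suc l"])
        (auto simp: B_def intro!: eq_vecI)
    then show ?thesis
      by (simp add: row ldet_eq_det B_def)
  qed
  have "\<exists>e. e \<in> {1, -1} \<and> (j \<notin> I \<longrightarrow> rowcomb r M c j = e * plucker r M (insert j I))" for j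
  proof (cases "j \<in> I")
    case False
    then show ?thesis
      unfolding row using ldet_columns_eq_plucker[of "j # js" "insert j I" r M] js r by auto
  qed auto
  then obtain \<epsilon> where "\<And>j. \<epsilon> j \<in> {1, -1}"
    "\<And>j. j \<notin> I \<Longrightarrow> rowcomb r M c j = \<epsilon> j * plucker r M (insert j I)"
    by metis
  with zero show ?thesis
    by (intro exI[of _ c] exI[of _ \<epsilon>]) auto
qed

text \<open>Border the columns \<open>J\<close> of \<open>M\<close> by \<open>w\<close> as a new top
  row. The determinant vanishes when \<open>w\<close> is a combination of the rows of
  \<open>M\<close>, and its expansion along the top row is the stated linear equation in
  \<open>w\<close>.\<close>

lemma row_space_plucker_equations:
  assumes J: "J \<in> subsets_of_size n (s + 1)"
  shows "\<exists>\<delta>. (\<forall>k. \<delta> k \<in> {1, -1 :: 'k::field}) \<and>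
    (\<forall>w\<in>range (rowcomb s M). (\<Sum>k\<in>J. \<delta> k * w k * plucker s M (J - {k})) = 0)"
proof -
  define ks where "ks = sorted_list_of_set J"
  have fin: "finite J"
    using J finite_subset by (auto simp: subsets_of_size_def)
  have ks: "distinct ks" "set ks = J" "length ks = Suc s"
    using J fin by (auto simp: ks_def subsets_of_size_def)
  define C where "C w = Matrix.mat (Suc s) (Suc s)
    (\<lambda>(i, l). (case i of 0 \<Rightarrow> w (ks ! l) | Suc i' \<Rightarrow> M i' (ks ! l)))" for w :: "nat \<Rightarrow> 'k"
  \<comment> \<open>Cofactors along the top row do not involve \<open>w\<close>, so they are
    computed once, with top row 0.\<close>
  have "\<exists>e. e \<in> {1, -1} \<and> (l < Suc s \<longrightarrow> cofactor (C (\<lambda>_. 0)) 0 l = e * plucker s M (J - {ks ! l}))"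
    for l
  proof (cases "l < Suc s")
    case l: True
    \<comment> \<open>\<open>insert_index l\<close> skips position \<open>l\<close>, so
      \<open>xs\<close> lists \<open>J\<close> without its \<open>l\<close>-th element.\<close>
    define xs where "xs = map (\<lambda>m. ks ! insert_index l m) [0..<s]"
    have xs: "distinct xs"
      using ks l unfolding xs_def
      by (auto simp: distinct_map inj_on_def nth_eq_iff_index_eq insert_index_def split: if_splits)
    have "set xs \<subseteq> J - {ks ! l}"
      using ks l unfolding xs_def
      by (auto simp: nth_eq_iff_index_eq insert_index_def split: if_splits)
    moreover have "card (set xs) = card (J - {ks ! l})"
      using ks l J distinct_card[OF xs] fin
      by (subst card_Diff_singleton) (auto simp: xs_def subsets_of_size_def)
    ultimately have set: "set xs = J - {ks ! l}"
      using fin by (intro card_subset_eq) auto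
    have len: "length xs = s"
      by (simp add: xs_def)
    have "mat_delete (C (\<lambda>_. 0)) 0 l = Matrix.mat s s (\<lambda>(i, m). M i (xs ! m))"
      using l by (intro eq_matI) (auto simp: mat_delete_def C_def xs_def insert_index_def)
    then have "cofactor (C (\<lambda>_. 0)) 0 l = (- 1) ^ l * ldet s (\<lambda>k m. M k (xs ! m))"
      by (simp add: cofactor_def ldet_eq_det)
    moreover obtain e where "e \<in> {1, -1}" "ldet s (\<lambda>k m. M k (xs ! m)) = e * plucker s M (J - {ks ! l})"
      using ldet_columns_eq_plucker[OF xs set, of s M] len by blast
    ultimately show ?thesis
      by (intro exI[of _ "(- 1) ^ l * e"]) (cases "even l"; auto)
  qed auto
  then obtain e where e: "\<And>l. e l \<in> {1, -1 :: 'k}"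
    and cof0: "\<And>l. l < Suc s \<Longrightarrow> cofactor (C (\<lambda>_. 0)) 0 l = e l * plucker s M (J - {ks ! l})"
    by metis
  have cof: "cofactor (C w) 0 l = e l * plucker s M (J - {ks ! l})" if "l < Suc s" for w l
  proof -
    have "mat_delete (C w) 0 l = mat_delete (C (\<lambda>_. 0)) 0 l"
      by (intro eq_matI) (auto simp: mat_delete_def C_def)
    then show ?thesis
      using cof0[OF that] by (simp add: cofactor_def)
  qed
  have C0: "C w $$ (0, l) = w (ks ! l)" if "l < Suc s" for w l
    using that by (simp add: C_def)
  have bij: "bij_betw ((!) ks) {..<Suc s} J"
    using ks by (intro bij_betw_nth) auto
  \<comment> \<open>The signs \<open>e\<close> are indexed by positions in \<open>ks\<close>; this
    transfers them to elements of \<open>J\<close>.\<close>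
  define \<delta> where "\<delta> k = e (inv_into {..<Suc s} ((!) ks) k)" for k
  define F where "F w = (\<Sum>k\<in>J. \<delta> k * w k * plucker s M (J - {k}))" for w
  have F: "F w = Determinant.det (C w)" for w
  proof -
    have "Determinant.det (C w) = (\<Sum>l<Suc s. C w $$ (0, l) * cofactor (C w) 0 l)"
      by (intro laplace_expansion_row) (auto simp: C_def)
    also have "\<dots> = (\<Sum>l<Suc s. \<delta> (ks ! l) * w (ks ! l) * plucker s M (J - {ks ! l}))"
      using bij by (intro sum.cong)
        (auto simp: cof C0 \<delta>_def bij_betw_inv_into_left simp del: sum.lessThan_Suc)
    also have "\<dots> = F w"
      unfolding F_def by (rule sum.reindex_bij_betw[OF bij])
    finally show ?thesis ..
  qed
  have zero: "F (M i) = 0" if "i < s" for i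
    unfolding F using that
    by (intro det_identical_rows[of _ "Suc s" 0 "Suc i"]) (auto simp: C_def intro!: eq_vecI)
  \<comment> \<open>\<open>F\<close> is linear in \<open>w\<close>, so its vanishing on each row of
    \<open>M\<close>, where a row is repeated, gives vanishing on the row space.\<close>
  have "F (rowcomb s M c) = (\<Sum>i<s. c i * F (M i))" for c
    unfolding F_def rowcomb_def
    by (simp add: sum_distrib_left sum_distrib_right mult_ac sum.swap[of _ J])
  then have "F w = 0" if "w \<in> range (rowcomb s M)" for w
    using that zero by auto
  then show ?thesis
    using e by (intro exI[of _ \<delta>]) (auto simp: \<delta>_def F_def)
qed

text \<open>The signed coordinates \<open>p\<^bsub>I \<union> j\<^esub>\<close> form a vector \<open>v\<close> of the source space, and the
  linear equations of the target space evaluated at \<open>A v\<close> are the quiver Pluecker relations.\<close>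
lemma quiver_plucker_relation:
  fixes A :: "nat \<Rightarrow> nat \<Rightarrow> 'k::field"
  assumes M: "basis_matrix n r M N" and M': "basis_matrix n s M' N'"
    and sub: "matvec n A ` N \<subseteq> N'"
    and I: "I \<in> subsets_of_size n (r - 1)" and r: "1 \<le> r"
    and J: "J \<in> subsets_of_size n (s + 1)"
  obtains \<epsilon> \<delta> where "\<And>j. \<epsilon> j \<in> {1, -1}" "\<And>k. \<delta> k \<in> {1, -1}"
    "(\<Sum>(j, k)\<in>({..<n} - I) \<times> J.
       \<epsilon> j * \<delta> k * (A k j * plucker r M (insert j I) * plucker s M' (J - {k}))) = 0"
proof -
  obtain c \<epsilon> where \<epsilon>: "\<And>j. \<epsilon> j \<in> {1, -1}"
    and v: "\<And>j. rowcomb r M c j = (if j \<in> I then 0 else \<epsilon> j * plucker r M (insert j I))"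
    using plucker_vector_in_row_space[OF I r, of M] by blast
  obtain \<delta> where \<delta>: "\<And>k. \<delta> k \<in> {1, -1}"
    and eq: "\<And>w. w \<in> N' \<Longrightarrow> (\<Sum>k\<in>J. \<delta> k * w k * plucker s M' (J - {k})) = 0"
    using row_space_plucker_equations[OF J, of M'] M' unfolding basis_matrix_def by metis
  define w where "w = matvec n A (rowcomb r M c)"
  have "w \<in> N'"
    using M sub by (auto simp: w_def basis_matrix_def)
  have w: "w k = (\<Sum>j\<in>{..<n} - I. A k j * (\<epsilon> j * plucker r M (insert j I)))" if "k \<in> J" for k
  proof -
    have "k < n"
      using that J by (auto simp: subsets_of_size_def)
    then have "w k = (\<Sum>j<n. A k j * rowcomb r M c j)"
      by (simp add: w_def matvec_def)
    also have "\<dots> = (\<Sum>j\<in>{..<n} - I. A k j * rowcomb r M c j)"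
      by (intro sum.mono_neutral_right) (auto simp: v)
    finally show ?thesis
      by (simp add: v)
  qed
  have "(\<Sum>(j, k)\<in>({..<n} - I) \<times> J.
       \<epsilon> j * \<delta> k * (A k j * plucker r M (insert j I) * plucker s M' (J - {k})))
     = (\<Sum>k\<in>J. \<delta> k * w k * plucker s M' (J - {k}))"
    unfolding sum.cartesian_product[symmetric]
    by (subst sum.swap, intro sum.cong) (auto simp: w sum_distrib_left sum_distrib_right mult_ac)
  with eq[OF \<open>w \<in> N'\<close>] show ?thesis
    by (intro that[OF \<epsilon> \<delta>]) simp
qed

lemma grassmann_plucker_relation:
  fixes M :: "nat \<Rightarrow> nat \<Rightarrow> 'k::field"
  assumes M: "basis_matrix n r M N"
    and I: "I \<in> subsets_of_size n (r - 1)" and r: "1 \<le> r"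
    and J: "J \<in> subsets_of_size n (r + 1)"
  obtains \<epsilon> where "\<And>j. \<epsilon> j \<in> {1, -1}"
    "(\<Sum>j\<in>J - I. \<epsilon> j * (plucker r M (insert j I) * plucker r M (J - {j}))) = 0"
proof -
  define E :: "nat \<Rightarrow> nat \<Rightarrow> 'k" where "E i j = (if i = j then 1 else 0)" for i j
  have "matvec n E v = v" if "v \<in> N" for v
  proof -
    \<comment> \<open>\<open>matvec n\<close> truncates at \<open>n\<close>, so \<open>E\<close>
      acts as the identity just on vectors supported below \<open>n\<close>.\<close>
    have "v j = 0" if "n \<le> j" for j
      using M \<open>v \<in> N\<close> that by (auto simp: basis_matrix_def rowcomb_def)
    then show ?thesis
      by (auto simp: matvec_def E_def fun_eq_iff if_distrib[of "\<lambda>x. x * _"] cong: if_cong)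
  qed
  then have "matvec n E ` N \<subseteq> N"
    by auto
  from quiver_plucker_relation[OF M M this I r J] obtain \<epsilon> \<delta>
    where s: "\<And>j. \<epsilon> j \<in> {1, -1}" "\<And>k. \<delta> k \<in> {1, -1}"
      and eq: "(\<Sum>(j, k)\<in>({..<n} - I) \<times> J.
       \<epsilon> j * \<delta> k * (E k j * plucker r M (insert j I) * plucker r M (J - {k}))) = 0"
    by blast
  let ?t = "\<lambda>j. \<epsilon> j * \<delta> j * (plucker r M (insert j I) * plucker r M (J - {j}))"
  have J': "J \<subseteq> {..<n}" "finite J"
    using J finite_subset by (auto simp: subsets_of_size_def)
  \<comment> \<open>The entries of \<open>E\<close> remove every term off the diagonal
    \<open>j = k\<close>, which leaves indices lying in \<open>J\<close> and outside
    \<open>I\<close>.\<close>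
  have "(\<Sum>(j, k)\<in>({..<n} - I) \<times> J.
       \<epsilon> j * \<delta> k * (E k j * plucker r M (insert j I) * plucker r M (J - {k})))
     = (\<Sum>j\<in>{..<n} - I. if j \<in> J then ?t j else 0)"
    unfolding sum.cartesian_product[symmetric] E_def using J'
    by (simp add: if_distrib[of "\<lambda>x. x * _"] if_distrib[of "\<lambda>x. _ * x"] cong: if_cong)
  also have "\<dots> = (\<Sum>j\<in>J - I. ?t j)"
    using J' by (subst sum.inter_restrict[symmetric]) (auto intro!: sum.cong)
  finally have "(\<Sum>j\<in>J - I. ?t j) = 0"
    using eq by simp
  moreover have "\<epsilon> j * \<delta> j \<in> {1, -1}" for j
    using s(1)[of j] s(2)[of j] by auto
  ultimately show ?thesis
    using that[of "\<lambda>j. \<epsilon> j * \<delta> j"] by blast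
qed

subsection \<open>Valuations and tropical vanishing\<close>

text \<open>A finite nonempty family attains its infimum, so failure means a unique minimizer with
  value below \<open>\<infinity>\<close>. Strict inequalities are easy to refute by a vanishing sum
  and are stable under perturbation.\<close>

lemma min_twice_iff_no_strict_min:
  assumes "finite S"
  shows "min_twice S f \<longleftrightarrow> \<not> (\<exists>a\<in>S. f a < \<infinity> \<and> (\<forall>b\<in>S - {a}. f a < f b))"
proof (cases "S = {}")
  case True
  then show ?thesis
    by (simp add: min_twice_def top_ereal_def)
next
  case False
  have "(INF s\<in>S. f s) = Min (f ` S)"
    using assms False by (simp add: Min_Inf)
  then obtain m where m: "m \<in> S" "f m = (INF s\<in>S. f s)"
    using Min_in[of "f ` S"] assms False by fastforce
  have le: "f m \<le> f b" if "b \<in> S" for b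
    using that m by (simp add: INF_lower)
  show ?thesis
    unfolding min_twice_def m(2)[symmetric]
  proof (intro iffI notI)
    assume "\<not> (\<exists>a\<in>S. f a < \<infinity> \<and> (\<forall>b\<in>S - {a}. f a < f b))"
    then have "f m = \<infinity> \<or> (\<exists>b\<in>S - {m}. \<not> f m < f b)"
      using m(1) by auto
    then show "f m = \<infinity> \<or> (\<exists>a\<in>S. \<exists>b\<in>S. a \<noteq> b \<and> f a = f m \<and> f b = f m)"
      using m(1) le by (auto simp: not_less dest!: antisym)
  next
    assume tw: "f m = \<infinity> \<or> (\<exists>a\<in>S. \<exists>b\<in>S. a \<noteq> b \<and> f a = f m \<and> f b = f m)"
      and "\<exists>a\<in>S. f a < \<infinity> \<and> (\<forall>b\<in>S - {a}. f a < f b)"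
    then obtain a where a: "a \<in> S" "f a < \<infinity>" "\<And>b. b \<in> S \<Longrightarrow> b \<noteq> a \<Longrightarrow> f a < f b"
      by blast
    have "m = a"
      using a(3)[OF m(1)] le[OF a(1)] leD by blast
    with tw a show False
      by (metis less_irrefl)
  qed
qed

lemma val_one:
  assumes "nonarch_valuation val"
  shows "val 1 = 0"
proof -
  have "val 1 = val 1 + val 1" "val 1 \<noteq> \<infinity>" "val 1 \<noteq> -\<infinity>"
    using assms unfolding nonarch_valuation_def by (metis mult_1, auto)
  then show ?thesis
    by (cases "val 1") auto
qed

text \<open>From \<open>(-1) * (-1) = 1\<close> the valuation of -1 doubles to 0, hence is
  0.\<close>

lemma val_sign:
  assumes v: "nonarch_valuation val" and "e \<in> {1, -1}"
  shows "val (e * x) = val x"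
proof -
  have "val (-1) + val (-1) = 0"
    using v val_one[OF v] unfolding nonarch_valuation_def by (metis mult_minus1 minus_minus)
  then have "val (-1) = 0"
    by (cases "val (-1)") (auto simp: zero_ereal_def)
  then show ?thesis
    using assms val_one[OF v] unfolding nonarch_valuation_def by auto
qed

text \<open>The strict form of the ultrametric inequality. The bound \<open>b < \<infinity>\<close>
  covers the empty sum, whose valuation is \<open>\<infinity>\<close>.\<close>

lemma val_sum_gt:
  assumes v: "nonarch_valuation val" and "finite S" "b < \<infinity>" "\<And>s. s \<in> S \<Longrightarrow> b < val (t s)"
  shows "b < val (\<Sum>s\<in>S. t s)"
  using assms(2,4)
proof (induction S rule: finite_induct)
  case empty
  have "val 0 = \<infinity>"
    using v unfolding nonarch_valuation_def by blast
  then show ?case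
    using \<open>b < \<infinity>\<close> by simp
next
  case (insert s S)
  have "b < min (val (t s)) (val (\<Sum>s\<in>S. t s))"
    using insert by auto
  also have "\<dots> \<le> val (t s + (\<Sum>s\<in>S. t s))"
    using v unfolding nonarch_valuation_def by blast
  finally show ?case
    using insert by simp
qed

text \<open>A term of strictly smallest valuation would equal minus the sum of the others, whose
  valuation is strictly larger. The constant \<open>c\<close> accounts for the choice of
  representatives in tropical projective space.\<close>

lemma min_twice_of_sum_eq_zero:
  assumes v: "nonarch_valuation val" and fin: "finite S" and sum: "(\<Sum>s\<in>S. t s) = 0"
    and f: "\<And>s. s \<in> S \<Longrightarrow> f s = val (t s) + ereal c"
  shows "min_twice S f"
  unfolding min_twice_iff_no_strict_min[OF fin]
proof
  assume "\<exists>a\<in>S. f a < \<infinity> \<and> (\<forall>b\<in>S - {a}. f a < f b)"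
  then obtain a where a: "a \<in> S" "f a < \<infinity>" "\<And>b. b \<in> S - {a} \<Longrightarrow> f a < f b"
    by blast
  have less: "val (t a) < val (t b)" if "b \<in> S - {a}" for b
    using a(3)[OF that] that a(1) by (cases "val (t a)"; cases "val (t b)") (auto simp: f)
  have "val (t a) < \<infinity>"
    using a by (auto simp: f)
  then have "val (t a) < val (\<Sum>s\<in>S - {a}. t s)"
    using less fin by (intro val_sum_gt[OF v]) auto
  moreover have "(\<Sum>s\<in>S - {a}. t s) = (-1) * t a"
    using sum fin a(1) by (simp add: sum_diff1)
  ultimately show False
    using val_sign[OF v, of "-1" "t a"] by simp
qed

lemma min_twice_closure:
  fixes F :: "'a::topological_space \<Rightarrow> 'b \<Rightarrow> ereal"
  assumes fin: "finite S" and x: "x \<in> closure X"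
    and lim: "\<And>s. s \<in> S \<Longrightarrow> ((\<lambda>y. F y s) \<longlongrightarrow> F x s) (nhds x)"
    and X: "\<And>y. y \<in> X \<Longrightarrow> min_twice S (F y)"
  shows "min_twice S (F x)"
proof (rule ccontr)
  assume "\<not> min_twice S (F x)"
  then obtain a where a: "a \<in> S" "F x a < \<infinity>" "\<And>b. b \<in> S - {a} \<Longrightarrow> F x a < F x b"
    unfolding min_twice_iff_no_strict_min[OF fin] by blast
  have "eventually (\<lambda>y. F y a < \<infinity>) (nhds x)"
    using order_tendstoD(2)[OF lim[OF a(1)] a(2)] .
  moreover have "eventually (\<lambda>y. F y a < F y b) (nhds x)" if b: "b \<in> S - {a}" for b
  proof -
    \<comment> \<open>A fixed value in between splits the comparison of two varying quantities into
      two one-sided bounds, each an open condition.\<close>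
    obtain m where m: "F x a < m" "m < F x b"
      using a(3)[OF b] dense by blast
    have "eventually (\<lambda>y. F y a < m) (nhds x)" "eventually (\<lambda>y. m < F y b) (nhds x)"
      using order_tendstoD(2)[OF lim[OF a(1)] m(1)] order_tendstoD(1)[OF lim m(2)] b by auto
    then show ?thesis
      by eventually_elim simp
  qed
  then have "eventually (\<lambda>y. \<forall>b\<in>S - {a}. F y a < F y b) (nhds x)"
    using fin by (intro eventually_ball_finite) auto
  ultimately have "eventually (\<lambda>y. F y a < \<infinity> \<and> (\<forall>b\<in>S - {a}. F y a < F y b)) (nhds x)"
    by eventually_elim simp
  then obtain U where U: "open U" "x \<in> U"
    "\<And>y. y \<in> U \<Longrightarrow> F y a < \<infinity> \<and> (\<forall>b\<in>S - {a}. F y a < F y b)"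
    unfolding eventually_nhds by blast
  then obtain y where "y \<in> X" "y \<in> U"
    using x closure_iff_nhds_not_empty[of x X] by blast
  then show False
    using X[of y] U(3)[of y] a(1) unfolding min_twice_iff_no_strict_min[OF fin] by blast
qed

lemma tendsto_coordinate: "((\<lambda>y. y i I) \<longlongrightarrow> x i I) (nhds (x :: 'a \<Rightarrow> 'b \<Rightarrow> 'c::topological_space))"
proof -
  have "continuous_on UNIV (\<lambda>y :: 'a \<Rightarrow> 'b \<Rightarrow> 'c. y i I)"
    by (rule continuous_on_product_then_coordinatewise[OF continuous_on_product_coordinates])
  then have "open ((\<lambda>y :: 'a \<Rightarrow> 'b \<Rightarrow> 'c. y i I) -` S)" if "open S" for S
    using that by (rule open_vimage[rotated])
  then show ?thesis
    by (intro topological_tendstoI) (force simp: eventually_nhds)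
qed

subsection \<open>The quiver Dressian contains the tropical quiver Grassmannian\<close>

lemma insert_in_subsets_of_size:
  assumes "I \<in> subsets_of_size n (r - 1)" "1 \<le> r" "j < n" "j \<notin> I"
  shows "insert j I \<in> subsets_of_size n r"
proof -
  have "finite I"
    using assms finite_subset by (auto simp: subsets_of_size_def)
  then show ?thesis
    using assms by (auto simp: subsets_of_size_def)
qed

lemma remove_in_subsets_of_size:
  assumes "J \<in> subsets_of_size n (s + 1)" "k \<in> J"
  shows "J - {k} \<in> subsets_of_size n s"
proof -
  have "finite J"
    using assms finite_subset by (auto simp: subsets_of_size_def)
  then show ?thesis
    using assms by (auto simp: subsets_of_size_def)
qed

lemma trop_closure_QGr_subset_QDr:
  assumes v: "nonarch_valuation val" and Q: "quiver_dimvec V Arr src tgt n d"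
  shows "trop_closure_QGr val V Arr src tgt A d n \<subseteq> QDr val V Arr src tgt A d n"
proof
  fix x assume "x \<in> trop_closure_QGr val V Arr src tgt A d n"
  then have cl: "x \<in> closure (trop_QGr val V Arr src tgt A d n)" and rep: "trop_rep V d n x"
    by (auto simp: trop_closure_QGr_def)
  have x: "x i I \<noteq> -\<infinity>" for i I
    using rep by (auto simp: trop_rep_def)
  have val: "val y \<noteq> -\<infinity>" "val (y * z) = val y + val z" for y z
    using v by (auto simp: nonarch_valuation_def)
  have "min_twice (J - I) (\<lambda>j. x i (insert j I) + x i (J - {j}))"
    if i: "i \<in> V" and I: "I \<in> subsets_of_size n (d i - 1)" and r: "1 \<le> d i"
      and J: "J \<in> subsets_of_size n (d i + 1)" for i I J
  proof (rule min_twice_closure[OF _ cl])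
    have Jn: "J \<subseteq> {..<n}"
      using J by (auto simp: subsets_of_size_def)
    then show fin: "finite (J - I)"
      using finite_subset by blast
    \<comment> \<open>Addition of extended reals is continuous at \<open>x\<close> because no
      coordinate of \<open>x\<close> is \<open>-\<infinity>\<close>.\<close>
    show "((\<lambda>y. y i (insert j I) + y i (J - {j})) \<longlongrightarrow> x i (insert j I) + x i (J - {j})) (nhds x)"
      for j
      by (intro tendsto_add_ereal_nonneg tendsto_coordinate x)
    fix y assume "y \<in> trop_QGr val V Arr src tgt A d n"
    then obtain N M c where M: "basis_matrix n (d i) (M i) (N i)"
      and y: "\<And>I. I \<in> subsets_of_size n (d i) \<Longrightarrow>
        y i I = val (plucker (d i) (M i) I) + ereal (c i)"
      using i unfolding trop_QGr_def by auto
    obtain \<epsilon> where \<epsilon>: "\<And>j. \<epsilon> j \<in> {1, -1}"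
      and sum: "(\<Sum>j\<in>J - I. \<epsilon> j * (plucker (d i) (M i) (insert j I) * plucker (d i) (M i) (J - {j}))) = 0"
      using grassmann_plucker_relation[OF M I r J] by blast
    show "min_twice (J - I) (\<lambda>j. y i (insert j I) + y i (J - {j}))"
    \<comment> \<open>Both factors belong to vertex \<open>i\<close>, so every term is shifted by
      the same constant \<open>c i + c i\<close>.\<close>
    proof (rule min_twice_of_sum_eq_zero[OF v fin sum])
      fix j assume j: "j \<in> J - I"
      then have "insert j I \<in> subsets_of_size n (d i)" "J - {j} \<in> subsets_of_size n (d i)"
        using Jn insert_in_subsets_of_size[OF I r, of j] remove_in_subsets_of_size[OF J, of j] by auto
      then show "y i (insert j I) + y i (J - {j}) =
        val (\<epsilon> j * (plucker (d i) (M i) (insert j I) * plucker (d i) (M i) (J - {j})))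
          + ereal (c i + c i)"
        unfolding val_sign[OF v \<epsilon>]
        by (simp only: val(2) y plus_ereal.simps(1)[symmetric] add_ac)
    qed
  qed
  moreover have "min_twice (({..<n} - I) \<times> J)
      (\<lambda>(j, k). val (A a k j) + x (src a) (insert j I) + x (tgt a) (J - {k}))"
    if a: "a \<in> Arr" and I: "I \<in> subsets_of_size n (d (src a) - 1)" and r: "1 \<le> d (src a)"
      and J: "J \<in> subsets_of_size n (d (tgt a) + 1)" for a I J
  proof (rule min_twice_closure[OF _ cl])
    have Jn: "J \<subseteq> {..<n}"
      using J by (auto simp: subsets_of_size_def)
    then show fin: "finite (({..<n} - I) \<times> J)"
      using finite_subset by blast
    show "((\<lambda>y. case s of (j, k) \<Rightarrow> val (A a k j) + y (src a) (insert j I) + y (tgt a) (J - {k}))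
      \<longlongrightarrow> (case s of (j, k) \<Rightarrow> val (A a k j) + x (src a) (insert j I) + x (tgt a) (J - {k})))
      (nhds x)" for s
      unfolding case_prod_beta
      by (intro tendsto_add_ereal_nonneg tendsto_coordinate tendsto_const) (auto simp: x val)
    fix y assume "y \<in> trop_QGr val V Arr src tgt A d n"
    then obtain N M c where "N \<in> QGr V Arr src tgt A d n \<and>
        (\<forall>i\<in>V. basis_matrix n (d i) (M i) (N i)) \<and>
        (\<forall>i I. y i I = (if i \<in> V \<and> I \<in> subsets_of_size n (d i)
           then val (plucker (d i) (M i) I) + ereal (c i) else \<infinity>))"
      unfolding trop_QGr_def by blast
    then have N: "N \<in> QGr V Arr src tgt A d n"
      and M: "\<And>i. i \<in> V \<Longrightarrow> basis_matrix n (d i) (M i) (N i)"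
      and y: "\<And>i I. i \<in> V \<Longrightarrow> I \<in> subsets_of_size n (d i) \<Longrightarrow>
        y i I = val (plucker (d i) (M i) I) + ereal (c i)"
      by auto
    have V: "src a \<in> V" "tgt a \<in> V"
      using Q a by (auto simp: quiver_dimvec_def)
    have "matvec n (A a) ` N (src a) \<subseteq> N (tgt a)"
      using N a by (auto simp: QGr_def)
    from quiver_plucker_relation[OF M[OF V(1)] M[OF V(2)] this I r J]
    obtain \<epsilon> \<delta> where \<epsilon>: "\<And>j. \<epsilon> j \<in> {1, -1}" and \<delta>: "\<And>k. \<delta> k \<in> {1, -1}"
      and sum: "(\<Sum>(j, k)\<in>({..<n} - I) \<times> J. \<epsilon> j * \<delta> k * (A a k j *
        plucker (d (src a)) (M (src a)) (insert j I) * plucker (d (tgt a)) (M (tgt a)) (J - {k}))) = 0"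
      by blast
    show "min_twice (({..<n} - I) \<times> J)
      (\<lambda>(j, k). val (A a k j) + y (src a) (insert j I) + y (tgt a) (J - {k}))"
    proof (rule min_twice_of_sum_eq_zero[OF v fin sum, of _ "c (src a) + c (tgt a)"], safe)
      fix j k assume jk: "j < n" "j \<notin> I" "k \<in> J"
      have "insert j I \<in> subsets_of_size n (d (src a))" "J - {k} \<in> subsets_of_size n (d (tgt a))"
        using jk insert_in_subsets_of_size[OF I r, of j] remove_in_subsets_of_size[OF J, of k] by auto
      then show "val (A a k j) + y (src a) (insert j I) + y (tgt a) (J - {k}) =
        val (\<epsilon> j * \<delta> k * (A a k j * plucker (d (src a)) (M (src a)) (insert j I) *
          plucker (d (tgt a)) (M (tgt a)) (J - {k}))) + ereal (c (src a) + c (tgt a))"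
        unfolding mult.assoc[of "\<epsilon> j"] val_sign[OF v \<epsilon>] val_sign[OF v \<delta>]
        by (simp only: val(2) y V plus_ereal.simps(1)[symmetric] add_ac)
    qed
  qed
  ultimately show "x \<in> QDr val V Arr src tgt A d n"
    using rep by (auto simp: QDr_def)
qed

subsection \<open>Representations on a line and the shear\<close>

lemma plucker_one: "plucker 1 M {j} = M 0 j"
  by (simp add: plucker_def ldet_eq_det det_single)

lemma plucker_zero: "plucker 0 M I = 1"
  by (simp add: plucker_def ldet_eq_det)

text \<open>No limit is taken: each vertex has a single coordinate, so a point of the Dressian is a
  rescaling of the tropicalization of the one possible tuple of subspaces, once that tuple is known
  to be a subrepresentation.\<close>

lemma QDr_one_subset_trop_closure_QGr:
  assumes v: "nonarch_valuation val" and Q: "quiver_dimvec V Arr src tgt 1 d"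
  shows "QDr val V Arr src tgt A d 1 \<subseteq> trop_closure_QGr val V Arr src tgt A d 1"
proof
  fix x assume x: "x \<in> QDr val V Arr src tgt A d 1"
  then have rep: "trop_rep V d 1 x"
    by (simp add: QDr_def)
  \<comment> \<open>The first \<open>d i\<close> rows of \<open>M\<close> are a basis of the zero
    space or of the whole line.\<close>
  define M :: "nat \<Rightarrow> nat \<Rightarrow> 'a" where "M k j = (if j = 0 then 1 else 0)" for k j
  define N where "N i = range (rowcomb (d i) M)" for i
  have d: "d i = 0 \<or> d i = 1" if "i \<in> V" for i
    using Q that by (force simp: quiver_dimvec_def)
  \<comment> \<open>\<open>{..<d i}\<close> writes both cases, \<open>{}\<close> and
    \<open>{0}\<close>, uniformly.\<close>
  have subs: "subsets_of_size 1 (d i) = {{..<d i}}" if "i \<in> V" for i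
    using d[OF that] by (auto simp: subsets_of_size_def subset_singleton_iff lessThan_Suc)
  have basis: "basis_matrix 1 (d i) M (N i)" if "i \<in> V" for i
    using d[OF that] by (auto simp: basis_matrix_def N_def M_def rowcomb_def fun_eq_iff)
  have pl: "plucker (d i) M {..<d i} = 1" if "i \<in> V" for i
    using d[OF that] plucker_one[of M 0] by (auto simp: plucker_zero M_def lessThan_Suc)
  have "matvec 1 (A a) ` N (src a) \<subseteq> N (tgt a)" if a: "a \<in> Arr" for a
  proof -
    have V: "src a \<in> V" "tgt a \<in> V"
      using Q a by (auto simp: quiver_dimvec_def)
    consider "d (src a) = 0" | "d (tgt a) = 1" | "d (src a) = 1" "d (tgt a) = 0"
      using d[OF V(1)] d[OF V(2)] by auto
    then show ?thesis
    proof cases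
      case 1
      have "matvec 1 (A a) (rowcomb 0 M c) = rowcomb (d (tgt a)) M (\<lambda>_. 0)" for c
        by (simp add: matvec_def rowcomb_def fun_eq_iff)
      with 1 show ?thesis
        by (auto simp: N_def)
    next
      case 2
      have "matvec 1 (A a) u = rowcomb 1 M (matvec 1 (A a) u)" for u
        by (auto simp: rowcomb_def M_def fun_eq_iff matvec_def)
      then have "matvec 1 (A a) u \<in> range (rowcomb 1 M)" for u
        by (metis rangeI)
      with 2 show ?thesis
        by (auto simp: N_def)
    next
      case 3
      \<comment> \<open>The relation for \<open>I = {}\<close> and \<open>J = {0}\<close> has a
        single term, whose minimum counts as attained twice just when it is
        \<open>\<infinity>\<close>; this forces the matrix entry to vanish.\<close>
      have "min_twice (({..<1} - {}) \<times> {0})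
          (\<lambda>(j, k). val (A a k j) + x (src a) (insert j {}) + x (tgt a) ({0} - {k}))"
      proof -
        have "{} \<in> subsets_of_size 1 (d (src a) - 1) \<and> 1 \<le> d (src a) \<and>
            {0} \<in> subsets_of_size 1 (d (tgt a) + 1)"
          using 3 by (simp add: subsets_of_size_def)
        then show ?thesis
          using x a unfolding QDr_def by blast
      qed
      moreover have "({..<1 :: nat} - {}) \<times> {0 :: nat} = {(0, 0)}"
        by auto
      ultimately have "val (A a 0 0) + x (src a) {0} + x (tgt a) {} = \<infinity>"
        by (simp add: min_twice_def)
      moreover have "x (src a) {0} \<noteq> \<infinity>" "x (tgt a) {} \<noteq> \<infinity>"
        using rep V 3 subs[OF V(1)] subs[OF V(2)] unfolding trop_rep_def
        by (metis lessThan_0 lessThan_Suc One_nat_def singletonD)+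
      ultimately have "A a 0 0 = 0"
        using v by (auto simp: nonarch_valuation_def)
      \<comment> \<open>A combination of no rows is zero whatever the coefficients.\<close>
      then have "matvec 1 (A a) u = rowcomb 0 M undefined" for u
        by (simp add: matvec_def rowcomb_def fun_eq_iff)
      with 3 show ?thesis
        by (auto simp: N_def)
    qed
  qed
  then have "N \<in> QGr V Arr src tgt A d 1"
    using basis unfolding QGr_def subspace_of_dim_def by blast
  \<comment> \<open>The Pluecker coordinate is 1, of valuation 0, so the finite value of
    \<open>x\<close> serves as the scaling constant.\<close>
  moreover have "x i I = (if i \<in> V \<and> I \<in> subsets_of_size 1 (d i)
      then val (plucker (d i) M I) + ereal (real_of_ereal (x i {..<d i})) else \<infinity>)" for i I
  proof (cases "i \<in> V \<and> I \<in> subsets_of_size 1 (d i)")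
    case True
    then have "x i {..<d i} \<noteq> \<infinity>" "x i {..<d i} \<noteq> -\<infinity>"
      using rep subs[of i] unfolding trop_rep_def by (metis singletonD)+
    then show ?thesis
      using True subs[of i] by (cases "x i {..<d i}") (simp_all add: pl val_one[OF v])
  qed (use rep in \<open>auto simp: trop_rep_def\<close>)
  ultimately have "x \<in> trop_QGr val V Arr src tgt A d 1"
    using basis unfolding trop_QGr_def
    by (intro CollectI bexI[of _ N] exI[of _ "\<lambda>_. M"]
        exI[of _ "\<lambda>i. real_of_ereal (x i {..<d i})"]) auto
  then show "x \<in> trop_closure_QGr val V Arr src tgt A d 1"
    using rep closure_subset by (auto simp: trop_closure_QGr_def)
qed

section \<open>Strict containment for \<open>n \<ge> 2\<close>\<close>

lemma min_twiceI:
  assumes "a \<in> S" "b \<in> S" "a \<noteq> b" "f a = f b" "\<And>s. s \<in> S \<Longrightarrow> f a \<le> f s"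
  shows "min_twice S f"
proof -
  have "(INF s\<in>S. f s) = f a"
    using assms by (intro antisym INF_lower INF_greatest) auto
  with assms show ?thesis
    unfolding min_twice_def by metis
qed

definition shear :: "nat \<Rightarrow> nat \<Rightarrow> 'k::field" where
  "shear i j = (if i = j \<or> i = 0 \<and> j = 1 then 1 else 0)"

text \<open>Row 1 reads \<open>u 1 = c * u 1\<close>, so a nonzero \<open>u 1\<close> gives
  \<open>c = 1\<close>; then row 0 reads \<open>u 0 + u 1 = u 0\<close>.\<close>

lemma shear_eigenvector:
  fixes u :: "nat \<Rightarrow> 'k::field"
  assumes n: "2 \<le> n" and eig: "\<And>j. matvec n shear u j = c * u j"
  shows "u 1 = 0"
proof (rule ccontr)
  assume "u 1 \<noteq> 0"
  have "(\<Sum>j<n. shear 1 j * u j) = (\<Sum>j<n. if j = 1 then u j else 0)"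
    by (intro sum.cong) (auto simp: shear_def)
  then have "c = 1"
    using n eig[of 1] \<open>u 1 \<noteq> 0\<close> by (simp add: matvec_def)
  have "(\<Sum>j<n. shear 0 j * u j) = (\<Sum>j<n. (if j = 0 then u j else 0) + (if j = 1 then u j else 0))"
    by (intro sum.cong) (auto simp: shear_def)
  also have "\<dots> = u 0 + u 1"
    using n by (simp add: sum.distrib)
  finally show False
    using n eig[of 0] \<open>c = 1\<close> \<open>u 1 \<noteq> 0\<close> by (simp add: matvec_def)
qed

text \<open>In the quiver Pluecker relation of \<open>J = {k, l}\<close> the two diagonal terms
  \<open>p\<^sub>k p\<^sub>l\<close> cancel, but tropically they still attain the minimum twice. Hence the
  Dressian of the shear contains the origin, although \<open>p\<^sub>1 = 0\<close> on its invariant lines.\<close>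
lemma trop_closure_QGr_shear_psubset_QDr:
  fixes val :: "'k::field \<Rightarrow> ereal"
  assumes v: "nonarch_valuation val" and n: "2 \<le> n"
  defines "QD \<equiv> QDr val {0} {0} (\<lambda>_. 0) (\<lambda>_. 0) (\<lambda>_. shear) (\<lambda>_. 1) n"
    and "QG \<equiv> trop_closure_QGr val {0} {0} (\<lambda>_. 0) (\<lambda>_. 0) (\<lambda>_. shear) (\<lambda>_. 1) n"
  shows "QG \<subset> QD"
proof -
  \<comment> \<open>The origin: every Pluecker coordinate has value 0.\<close>
  define x :: "nat \<Rightarrow> nat set \<Rightarrow> ereal" where
    "x i I = (if i = 0 \<and> I \<in> subsets_of_size n 1 then 0 else \<infinity>)" for i I
  have sing: "{j} \<in> subsets_of_size n 1 \<longleftrightarrow> j < n" for j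
    by (auto simp: subsets_of_size_def)
  have rep: "trop_rep {0} (\<lambda>_. 1) n x"
    using sing[of 0] n unfolding trop_rep_def x_def by auto
  \<comment> \<open>Since \<open>d i - 1 = 0\<close>, the relations are indexed by
    \<open>I = {}\<close> alone.\<close>
  have empty: "I = {}" if "I \<in> subsets_of_size n 0" for I
    using that finite_subset[of I "{..<n}"] by (auto simp: subsets_of_size_def)
  have val01: "val 1 = 0" "val 0 = \<infinity>"
    using v val_one[OF v] by (auto simp: nonarch_valuation_def)
  have "min_twice (J - {}) (\<lambda>j. x 0 {j} + x 0 (J - {j})) \<and>
      min_twice (({..<n} - {}) \<times> J) (\<lambda>(j, k). val (shear k j) + x 0 {j} + x 0 (J - {k}))"
    if J: "J \<in> subsets_of_size n 2" for J
  proof -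
    obtain k l where kl: "k \<in> J" "l \<in> J" "k \<noteq> l"
      using J by (auto simp: subsets_of_size_def card_2_iff)
    have Jn: "j < n" if "j \<in> J" for j
      using J that by (auto simp: subsets_of_size_def)
    have x0: "x 0 {j} = 0" if "j < n" for j
      using that sing by (simp add: x_def)
    have x1: "x 0 (J - {j}) = 0" if "j \<in> J" for j
      using remove_in_subsets_of_size[of J n 1 j] J that by (simp add: x_def numeral_2_eq_2)
    have "min_twice (J - {}) (\<lambda>j. x 0 {j} + x 0 (J - {j}))"
      using kl by (intro min_twiceI[of k _ l]) (auto simp: x0 x1 Jn)
    moreover have "min_twice (({..<n} - {}) \<times> J)
        (\<lambda>(j, k). val (shear k j) + x 0 {j} + x 0 (J - {k}))"
      \<comment> \<open>All entries of \<open>shear\<close> have valuation 0 or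
        \<open>\<infinity>\<close>, so the two diagonal terms, of value 0, are minimal.\<close>
      using kl by (intro min_twiceI[of "(k, k)" _ "(l, l)"]) (auto simp: x0 x1 Jn shear_def val01)
    ultimately show ?thesis ..
  qed
  then have "x \<in> QD"
    using rep unfolding QD_def QDr_def by (auto dest!: empty simp: numeral_2_eq_2)
  moreover have "x \<notin> QG"
  proof
    assume "x \<in> QG"
    \<comment> \<open>Vanishing of the coordinate \<open>{1}\<close> is a closed condition, so it
      passes from the invariant lines to the closure, where it excludes the origin.\<close>
    have "closed {y :: nat \<Rightarrow> nat set \<Rightarrow> ereal. y 0 {1} = \<infinity>}"
      by (intro closed_Collect_eq continuous_on_const
          continuous_on_product_then_coordinatewise[OF continuous_on_product_coordinates])
    moreover have "trop_QGr val {0} {0} (\<lambda>_. 0) (\<lambda>_. 0) (\<lambda>_. shear) (\<lambda>_. 1) n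
        \<subseteq> {y. y 0 {1} = \<infinity>}"
    proof
      fix y assume "y \<in> trop_QGr val {0} {0} (\<lambda>_. 0) (\<lambda>_. 0) (\<lambda>_. shear) (\<lambda>_. 1) n"
      then obtain N M c where M: "basis_matrix n 1 (M 0) (N 0)"
        and N: "matvec n shear ` N 0 \<subseteq> N 0"
        and y: "y 0 {1} = val (plucker 1 (M 0) {1}) + ereal (c 0)"
        using sing[of 1] n unfolding trop_QGr_def QGr_def by auto
      have N0: "N 0 = range (\<lambda>(b :: nat \<Rightarrow> 'k) j. b 0 * M 0 0 j)"
        using M by (simp add: basis_matrix_def rowcomb_def[abs_def])
      \<comment> \<open>The row \<open>M 0 0\<close> spans the line \<open>N 0\<close>, so
        invariance makes it an eigenvector.\<close>
      have "M 0 0 \<in> N 0"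
        unfolding N0 by (rule range_eqI[of _ _ "\<lambda>_. 1"]) simp
      then have "matvec n shear (M 0 0) \<in> N 0"
        using N by blast
      then obtain b where "matvec n shear (M 0 0) = (\<lambda>j. b 0 * M 0 0 j)"
        unfolding N0 by auto
      then have "M 0 0 1 = 0"
        using shear_eigenvector[OF n, of "M 0 0" "b 0"] by metis
      then show "y \<in> {y. y 0 {1} = \<infinity>}"
        using y unfolding plucker_one by (simp add: val01)
    qed
    ultimately have "x 0 {1} = \<infinity>"
      using \<open>x \<in> QG\<close> closure_minimal unfolding QG_def trop_closure_QGr_def by blast
    then show False
      using sing[of 1] n by (simp add: x_def)
  qed
  moreover have "QG \<subseteq> QD"
    unfolding QG_def QD_def
    by (intro trop_closure_QGr_subset_QDr[OF v]) (use n in \<open>auto simp: quiver_dimvec_def\<close>)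
  ultimately show ?thesis
    by blast
qed

theorem theoremD:
  fixes val :: "'k::field \<Rightarrow> ereal"
  assumes "alg_closed TYPE('k)"
    and "nonarch_valuation val"
    and "nontrivial_valuation val"
  shows "(\<forall>V Arr src tgt A d. quiver_dimvec V Arr src tgt 1 d \<longrightarrow>
            QDr val V Arr src tgt A d 1 = trop_closure_QGr val V Arr src tgt A d 1)
       \<and> (\<forall>n\<ge>2.
            (\<forall>V Arr src tgt A d. quiver_dimvec V Arr src tgt n d \<longrightarrow>
               trop_closure_QGr val V Arr src tgt A d n \<subseteq> QDr val V Arr src tgt A d n)
          \<and> (\<exists>V Arr src tgt A d. quiver_dimvec V Arr src tgt n d \<and>
               trop_closure_QGr val V Arr src tgt A d n \<subset> QDr val V Arr src tgt A d n))"
proof (intro conjI allI impI)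
  fix V Arr src tgt d and A :: "nat \<Rightarrow> nat \<Rightarrow> nat \<Rightarrow> 'k"
  assume "quiver_dimvec V Arr src tgt 1 d"
  then show "QDr val V Arr src tgt A d 1 = trop_closure_QGr val V Arr src tgt A d 1"
    using assms(2) QDr_one_subset_trop_closure_QGr trop_closure_QGr_subset_QDr
    by (intro equalityI) blast+
next
  fix n :: nat and V Arr src tgt d and A :: "nat \<Rightarrow> nat \<Rightarrow> nat \<Rightarrow> 'k"
  assume "quiver_dimvec V Arr src tgt n d"
  then show "trop_closure_QGr val V Arr src tgt A d n \<subseteq> QDr val V Arr src tgt A d n"
    by (rule trop_closure_QGr_subset_QDr[OF assms(2)])
next
  fix n :: nat
  assume n: "2 \<le> n"
  then have "quiver_dimvec {0} {0} (\<lambda>_. 0) (\<lambda>_. 0) n (\<lambda>_. 1)"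
    by (auto simp: quiver_dimvec_def)
  with trop_closure_QGr_shear_psubset_QDr[OF assms(2) n]
  show "\<exists>V Arr src tgt A d. quiver_dimvec V Arr src tgt n d \<and>
      trop_closure_QGr val V Arr src tgt A d n \<subset> QDr val V Arr src tgt A d n"
    by blast
qed

end
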